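(* The class of CA-AG-groupoids is different from the class of AG*-groupoids and from the class of AG**-groupoids: there exists a CA-AG-groupoid that is not an AG*-groupoid, and there exists a CA-AG-groupoid that is not an AG**-groupoid.
   Context: A groupoid is a nonempty set $S$ with a binary operation, written as juxtaposition (a dot $\cdot$ may also separate factors, binding less tightly than juxtaposition). An AG-groupoid (Abel-Grassmann groupoid) is a groupoid $S$ satisfying the left invertive law $(ab)c=(cb)a$ for all $a,b,c\in S$. A CA-AG-groupoid (cyclic associative AG-groupoid) is an AG-groupoid $S$ satisfying $a(bc)=c(ab)$ for all $a,b,c\in S$. An AG*-groupoid is an AG-groupoid $S$ satisfying $(ab)c=b(ac)$ for all $a,b,c\in S$. An AG**-groupoid is an AG-groupoid $S$ satisfying $a(bc)=b(ac)$ for all $a,b,c\in S$. *)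

theory Defs
  imports Main
begin

locale groupoid =
  fixes S :: "'a set" and mult :: "'a \<Rightarrow> 'a \<Rightarrow> 'a" (infixl "\<cdot>" 70)
  assumes nonempty: "S \<noteq> {}"
    and closed: "\<lbrakk>a \<in> S; b \<in> S\<rbrakk> \<Longrightarrow> a \<cdot> b \<in> S"

locale AG_groupoid = groupoid +
  assumes left_invertive:
    "\<lbrakk>a \<in> S; b \<in> S; c \<in> S\<rbrakk> \<Longrightarrow> (a \<cdot> b) \<cdot> c = (c \<cdot> b) \<cdot> a"

locale CA_AG_groupoid = AG_groupoid +
  assumes cyclic_associative:
    "\<lbrakk>a \<in> S; b \<in> S; c \<in> S\<rbrakk> \<Longrightarrow> a \<cdot> (b \<cdot> c) = c \<cdot> (a \<cdot> b)"

locale AG_star_groupoid = AG_groupoid +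
  assumes AG_star:
    "\<lbrakk>a \<in> S; b \<in> S; c \<in> S\<rbrakk> \<Longrightarrow> (a \<cdot> b) \<cdot> c = b \<cdot> (a \<cdot> c)"

locale AG_star_star_groupoid = AG_groupoid +
  assumes AG_star_star:
    "\<lbrakk>a \<in> S; b \<in> S; c \<in> S\<rbrakk> \<Longrightarrow> a \<cdot> (b \<cdot> c) = b \<cdot> (a \<cdot> c)"

end

theory Submission
  imports Defs
begin

text \<open>
  One eight-element groupoid witnesses both claims. In a CA-AG-groupoid the value of
  \<open>x (y z)\<close> is invariant under cyclic permutations of \<open>x, y, z\<close>, whereas the AG**-law
  demands invariance under a transposition. So the idea is to take the three generators
  1, 2, 3 and make \<open>x (y z)\<close> nonzero exactly when \<open>(x, y, z)\<close> is a
  cyclic rotation of \<open>(1, 2, 3)\<close>, with one common value 7. For this the products \<open>2 3\<close>,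
  \<open>3 1\<close>, \<open>1 2\<close> are new elements 4, 5, 6, the products \<open>1 4\<close>, \<open>2 5\<close>, \<open>3 6\<close> are 7,
  and every other product is the zero element 0.

  Only a generator is the left factor of a nonzero product, and no product is a generator,
  so \<open>(x y) z = 0\<close> always and the left invertive law is trivial. As the rotation
  class of \<open>(1, 2, 3)\<close> does not contain \<open>(2, 1, 3)\<close>, both the AG*-law, via
  \<open>(2 1) 3 = 0 \<noteq> 7 = 1 (2 3)\<close>, and the AG**-law, via
  \<open>2 (1 3) = 0 \<noteq> 7 = 1 (2 3)\<close>, fail.
\<close>

definition cyclic_mult :: "nat \<Rightarrow> nat \<Rightarrow> nat" where
  "cyclic_mult x y =
    (if (x, y) = (2, 3) then 4
     else if (x, y) = (3, 1) then 5
     else if (x, y) = (1, 2) then 6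
     else if (x, y) \<in> {(1, 4), (2, 5), (3, 6)} then 7
     else 0)"

lemma cyclic_mult_left_nilpotent: "cyclic_mult (cyclic_mult x y) z = 0"
  by (simp add: cyclic_mult_def)

lemma cyclic_mult_right_nested:
  "cyclic_mult x (cyclic_mult y z) =
    (if (x, y, z) \<in> {(1, 2, 3), (2, 3, 1), (3, 1, 2)} then 7 else 0)"
  by (auto simp: cyclic_mult_def)

lemma CA_AG_groupoid_cyclic_mult: "CA_AG_groupoid {..7} cyclic_mult"
proof
  show "{..7::nat} \<noteq> {}"
    by blast
  show "cyclic_mult a b \<in> {..7}" for a b
    by (simp add: cyclic_mult_def)
  show "cyclic_mult (cyclic_mult a b) c = cyclic_mult (cyclic_mult c b) a" for a b c
    by (simp add: cyclic_mult_left_nilpotent)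
  show "cyclic_mult a (cyclic_mult b c) = cyclic_mult c (cyclic_mult a b)" for a b c
    by (auto simp: cyclic_mult_right_nested)
qed

lemma not_AG_star_groupoid_cyclic_mult: "\<not> AG_star_groupoid {..7} cyclic_mult"
proof
  assume "AG_star_groupoid {..7} cyclic_mult"
  then have "cyclic_mult (cyclic_mult 2 1) 3 = cyclic_mult 1 (cyclic_mult 2 3)"
    by (rule AG_star_groupoid.AG_star) auto
  then show False
    by (simp add: cyclic_mult_left_nilpotent cyclic_mult_right_nested)
qed

lemma not_AG_star_star_groupoid_cyclic_mult: "\<not> AG_star_star_groupoid {..7} cyclic_mult"
proof
  assume "AG_star_star_groupoid {..7} cyclic_mult"
  then have "cyclic_mult 2 (cyclic_mult 1 3) = cyclic_mult 1 (cyclic_mult 2 3)"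
    by (rule AG_star_star_groupoid.AG_star_star) auto
  then show False
    by (simp add: cyclic_mult_right_nested)
qed

theorem mainTheorem1:
  shows "(\<exists>(S :: nat set) mult. CA_AG_groupoid S mult \<and> \<not> AG_star_groupoid S mult) \<and>
         (\<exists>(S :: nat set) mult. CA_AG_groupoid S mult \<and> \<not> AG_star_star_groupoid S mult)"
  using CA_AG_groupoid_cyclic_mult not_AG_star_groupoid_cyclic_mult
    not_AG_star_star_groupoid_cyclic_mult by blast

end
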